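(* For every integer $r\geq1$, $$[x]\,U_{r-1}\!\left(\frac1x\right)(\arcsin x)^r=2^{r-1}.$$
   Context: $U_m$ is the Chebyshev polynomial of the second kind, normalized by $U_m(\cos\theta)=\frac{\sin((m+1)\theta)}{\sin\theta}$. For a Laurent series $F$, $[x]F(x)$ denotes the coefficient of $x^1$ in the Laurent expansion of $F$ at $x=0$; $\arcsin$ is the principal branch. *)

theory Defs
  imports "HOL-Complex_Analysis.Complex_Analysis"
begin

(* Real angles t suffice: cos t takes infinitely many values, so at most one polynomial
   satisfies the normalization. That there is exactly one is cheb_U_ex1. *)
definition is_cheb_U :: "nat \<Rightarrow> complex poly \<Rightarrow> bool" where
  "is_cheb_U m p \<longleftrightarrow> (\<forall>t::real. sin t \<noteq> 0 \<longrightarrow>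
     poly p (complex_of_real (cos t)) = complex_of_real (sin (real (m + 1) * t) / sin t))"

definition cheb_U :: "nat \<Rightarrow> complex poly" where
  "cheb_U m = (THE p. is_cheb_U m p)"

lemma is_cheb_U_0: "is_cheb_U 0 1"
  by (simp add: is_cheb_U_def)

lemma is_cheb_U_1: "is_cheb_U (Suc 0) [:0, 2:]"
  by (simp add: is_cheb_U_def sin_double)

lemma is_cheb_U_step:
  assumes "is_cheb_U m p" "is_cheb_U (Suc m) q"
  shows "is_cheb_U (Suc (Suc m)) ([:0, 2:] * q - p)"
  unfolding is_cheb_U_def
proof (intro allI impI)
  fix t :: real
  assume t: "sin t \<noteq> 0"
  define a where "a = real (m + 2) * t"
  have eqs: "real (m + 1) * t = a - t" "real (Suc m + 1) * t = a"
            "real (Suc (Suc m) + 1) * t = a + t"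
    by (simp_all add: a_def algebra_simps)
  have p: "poly p (complex_of_real (cos t)) = complex_of_real (sin (a - t) / sin t)"
    by (rule assms(1)[unfolded is_cheb_U_def, rule_format, OF t, unfolded eqs])
  have q: "poly q (complex_of_real (cos t)) = complex_of_real (sin a / sin t)"
    by (rule assms(2)[unfolded is_cheb_U_def, rule_format, OF t, unfolded eqs])
  have x: "poly [:0, 2:] (complex_of_real (cos t)) = complex_of_real (2 * cos t)"
    by simp
  have "poly ([:0, 2:] * q - p) (complex_of_real (cos t))
          = complex_of_real (2 * cos t * (sin a / sin t) - sin (a - t) / sin t)"
    by (simp only: poly_diff poly_mult p q x of_real_diff of_real_mult)
  also have "2 * cos t * (sin a / sin t) - sin (a - t) / sin t = sin (a + t) / sin t"
    using t by (simp add: sin_add sin_diff field_simps)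
  finally show "poly ([:0, 2:] * q - p) (complex_of_real (cos t))
      = complex_of_real (sin (real (Suc (Suc m) + 1) * t) / sin t)"
    by (simp only: eqs)
qed

lemma is_cheb_U_unique:
  assumes "is_cheb_U m p" "is_cheb_U m q"
  shows "p = q"
proof (rule ccontr)
  assume "p \<noteq> q"
  hence fin: "finite {x. poly (p - q) x = 0}"
    by (intro poly_roots_finite) simp
  have "complex_of_real ` {-1<..<1} \<subseteq> {x. poly (p - q) x = 0}"
  proof safe
    fix x :: real assume x: "x \<in> {-1<..<1}"
    hence "sin (arccos x) \<noteq> 0" "cos (arccos x) = x"
      by (simp_all add: sin_arccos_nonzero)
    thus "poly (p - q) (complex_of_real x) = 0"
      using assms[unfolded is_cheb_U_def, rule_format, of "arccos x"] by simp
  qed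
  hence "finite (complex_of_real ` {-1<..<1})"
    using fin finite_subset by blast
  hence "finite {-1<..<1::real}"
    by (rule finite_imageD) (simp add: inj_on_def)
  thus False
    by (simp add: infinite_Ioo)
qed

lemma cheb_U_ex1: "\<exists>!p. is_cheb_U m p"
proof -
  have "(\<exists>p. is_cheb_U m p) \<and> (\<exists>p. is_cheb_U (Suc m) p)"
  proof (induction m)
    case 0
    show ?case using is_cheb_U_0 is_cheb_U_1 by (intro conjI exI)
  next
    case (Suc m)
    then obtain p q where "is_cheb_U m p" "is_cheb_U (Suc m) q" by auto
    with is_cheb_U_step[OF this] show ?case by (intro conjI exI)
  qed
  then obtain p where p: "is_cheb_U m p" by auto
  show ?thesis
    by (rule ex1I[of _ p]) (use p in \<open>auto intro: is_cheb_U_unique\<close>)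
qed

lemma is_cheb_U_cheb_U: "is_cheb_U m (cheb_U m)"
  unfolding cheb_U_def by (rule theI') (rule cheb_U_ex1)

lemma cheb_U_0: "cheb_U 0 = 1"
  by (rule is_cheb_U_unique[OF is_cheb_U_cheb_U is_cheb_U_0])

lemma cheb_U_1: "cheb_U (Suc 0) = [:0, 2:]"
  by (rule is_cheb_U_unique[OF is_cheb_U_cheb_U is_cheb_U_1])

lemma cheb_U_rec: "cheb_U (Suc (Suc m)) = [:0, 2:] * cheb_U (Suc m) - cheb_U m"
  by (rule is_cheb_U_unique[OF is_cheb_U_cheb_U is_cheb_U_step]) (rule is_cheb_U_cheb_U)+

end

theory Submission
  imports Defs
begin

text \<open>
  As the polynomial \<open>U\<^bsub>r-1\<^esub>\<close> has degree \<open>r - 1\<close>, the product \<open>x\<^bsup>r-1\<^esup> U\<^bsub>r-1\<^esub>(1/x)\<close> is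
  its reflection, a polynomial in \<open>x\<close> with constant term \<open>2\<^bsup>r-1\<^esup>\<close>, the leading coefficient of
  \<open>U\<^bsub>r-1\<^esub>\<close>. Since \<open>arcsin x\<close> has a simple zero at the origin with derivative 1, the given function is
  \<open>x\<close> times an analytic function whose value at the origin is \<open>2\<^bsup>r-1\<^esup>\<close>.
\<close>

text \<open>In the recurrence the factor \<open>[:0, 2:]\<close> raises the degree by one and
  doubles the leading coefficient; the subtracted polynomial lies two degrees lower and cannot
  interfere.\<close>

lemma cheb_U_degree_lead_coeff:
  "degree (cheb_U m) = m \<and> lead_coeff (cheb_U m) = 2 ^ m"
proof (induction m rule: less_induct)
  case (less m)
  consider "m = 0" | "m = Suc 0" | k where "m = Suc (Suc k)"
    by (metis not0_implies_Suc)
  then show ?case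
  proof cases
    case (3 k)
    have k: "degree (cheb_U k) = k"
      and Sk: "degree (cheb_U (Suc k)) = Suc k" "coeff (cheb_U (Suc k)) (Suc k) = 2 ^ Suc k"
      using less.IH[of k] less.IH[of "Suc k"] 3 by auto
    have U: "cheb_U m = pCons 0 (smult 2 (cheb_U (Suc k))) - cheb_U k"
      by (simp add: 3 cheb_U_rec)
    have c: "coeff (cheb_U m) m = 2 ^ m"
      unfolding U using k Sk by (simp add: 3 coeff_eq_0)
    have "degree (cheb_U m) \<le> m"
      unfolding U using k Sk 3
      by (intro degree_diff_le order.trans[OF degree_pCons_le]) simp_all
    moreover have "m \<le> degree (cheb_U m)"
      by (rule le_degree) (simp add: c)
    ultimately show ?thesis
      using c by simp
  qed (simp_all add: cheb_U_0 cheb_U_1)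
qed

text \<open>With n the degree of \<open>p\<close>, each of the n + 1 factors \<open>f x\<close>
  supplies one \<open>x\<close>: n of them clear the pole of \<open>poly p (1 / x)\<close>, and one
  is left over.\<close>

lemma has_laurent_expansion_poly_inverse_times_power:
  fixes f :: "complex \<Rightarrow> complex"
  assumes f: "f has_fps_expansion F" and F: "fps_nth F 0 = 0" "fps_nth F 1 \<noteq> 0"
  obtains L where "(\<lambda>x. poly p (1 / x) * f x ^ Suc (degree p)) has_laurent_expansion L"
    and "fls_nth L 1 = lead_coeff p * fps_nth F 1 ^ Suc (degree p)"
proof -
  define n where "n = degree p"
  have "subdegree F = 1"
    using F by (intro subdegreeI) auto
  \<comment> \<open>The value at 0 fills the removable singularity of \<open>f x / x\<close>, as a
    power series expansion also fixes the value there.\<close>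
  then have shift: "(\<lambda>x. if x = 0 then fps_nth F 1 else f x / x ^ 1)
      has_fps_expansion fps_shift 1 F"
    by (intro has_fps_expansion_shift f) auto
  have reflect: "poly (reflect_poly p) has_fps_expansion fps_of_poly (reflect_poly p)"
    by (simp add: has_fps_expansion_def)
  define G where "G = fps_of_poly (reflect_poly p) * fps_shift 1 F ^ Suc n"
  have "(\<lambda>x. poly (reflect_poly p) x * (if x = 0 then fps_nth F 1 else f x / x ^ 1) ^ Suc n * x)
      has_fps_expansion G * fps_X"
    unfolding G_def by (intro fps_expansion_intros shift reflect)
  then have "(\<lambda>x. poly (reflect_poly p) x * (if x = 0 then fps_nth F 1 else f x / x ^ 1) ^ Suc n * x)
      has_laurent_expansion fps_to_fls (G * fps_X)"
    by (rule has_laurent_expansion_fps)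
  \<comment> \<open>A Laurent expansion sees only \<open>x \<noteq> 0\<close>, where
    \<open>poly (reflect_poly p) x\<close> is \<open>x ^ n * poly p (1 / x)\<close>.\<close>
  also have "?this \<longleftrightarrow>
      (\<lambda>x. poly p (1 / x) * f x ^ Suc n) has_laurent_expansion fps_to_fls (G * fps_X)"
  proof (rule has_laurent_expansion_cong[OF _ refl])
    show "\<forall>\<^sub>F x in at 0. poly (reflect_poly p) x *
        (if x = 0 then fps_nth F 1 else f x / x ^ 1) ^ Suc n * x = poly p (1 / x) * f x ^ Suc n"
      using eventually_neq_at_within[of 0]
      by eventually_elim (simp add: poly_reflect_poly_nz n_def power_divide inverse_eq_divide)
  qed
  finally have "(\<lambda>x. poly p (1 / x) * f x ^ Suc (degree p))
      has_laurent_expansion fps_to_fls (G * fps_X)"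
    by (simp only: n_def)
  \<comment> \<open>The factor \<open>fps_X\<close> reduces this to the constant term of
    \<open>G\<close>, and reflection puts the leading coefficient of \<open>p\<close> there.\<close>
  moreover have "fls_nth (fps_to_fls (G * fps_X)) 1 = lead_coeff p * fps_nth F 1 ^ Suc (degree p)"
    by (simp add: G_def n_def fps_nth_power_0)
  ultimately show ?thesis
    by (rule that)
qed

lemma Arcsin_has_fps_expansion:
  obtains F where "Arcsin has_fps_expansion F" "fps_nth F 0 = 0" "fps_nth F 1 = 1"
proof
  have "Arcsin holomorphic_on ball 0 1"
  proof (rule holomorphic_on_Arcsin)
    fix z :: complex
    assume "z \<in> ball 0 1"
    then show "\<bar>Re z\<bar> < 1"
      using abs_Re_le_cmod[of z] by simp
  qed
  then show F: "Arcsin has_fps_expansion fps_expansion Arcsin 0"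
    by (intro has_fps_expansion_fps_expansion[of "ball 0 1"]) auto
  show "fps_nth (fps_expansion Arcsin 0) 0 = 0"
    by (simp add: fps_nth_fps_expansion[OF F])
  have "(Arcsin has_field_derivative inverse (cos (Arcsin 0))) (at 0)"
    by (rule has_field_derivative_Arcsin) simp
  then have "deriv Arcsin 0 = 1"
    by (simp add: DERIV_imp_deriv)
  then show "fps_nth (fps_expansion Arcsin 0) 1 = 1"
    by (simp add: fps_nth_fps_expansion[OF F])
qed

theorem proposition3p7:
  fixes r :: nat
  assumes "r \<ge> 1"
  shows "let f = (\<lambda>x::complex. poly (cheb_U (r - 1)) (1 / x) * Arcsin x ^ r)
         in f has_laurent_expansion laurent_expansion f 0 \<and>
            fls_nth (laurent_expansion f 0) 1 = 2 ^ (r - 1)"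
proof -
  define f where "f = (\<lambda>x::complex. poly (cheb_U (r - 1)) (1 / x) * Arcsin x ^ r)"
  have deg: "Suc (degree (cheb_U (r - 1))) = r"
    and lead: "lead_coeff (cheb_U (r - 1)) = 2 ^ (r - 1)"
    using cheb_U_degree_lead_coeff[of "r - 1"] assms by (simp, blast)
  obtain F where F: "Arcsin has_fps_expansion F" "fps_nth F 0 = 0" "fps_nth F 1 = 1"
    by (rule Arcsin_has_fps_expansion)
  then have "fps_nth F 1 \<noteq> 0"
    by simp
  from has_laurent_expansion_poly_inverse_times_power[OF F(1,2) this, of "cheb_U (r - 1)"]
  obtain L where L: "f has_laurent_expansion L" "fls_nth L 1 = 2 ^ (r - 1)"
    unfolding deg lead F(3) f_def power_one mult_1_right .
  \<comment> \<open>Uniqueness of Laurent expansions.\<close>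
  have "laurent_expansion f 0 = L"
    using L(1) by (rule laurent_expansion_0_eqI)
  with L show ?thesis
    unfolding Let_def f_def[symmetric] by simp
qed

end
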